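(* For every integer $n\ge 3$, the achievement number of the path $P_n$ on $n$ vertices satisfies $$a(P_n)=\begin{cases}3, & n=3;\\ 5, & n=4;\\ n, & n\ge 5.\end{cases}$$
   Context: For a finite graph $G$ with no isolated vertices, the achievement game of $G$ on $K_N$ is played by Alice and Bob on the edges of the complete graph $K_N$, all initially uncolored: in each round Alice first colors one uncolored edge blue, then Bob colors one uncolored edge red. The player who first completes a copy of $G$ entirely in his or her own color wins; otherwise the game is a draw. The achievement number $a(G)$ is the smallest $N$ for which Alice has a winning strategy in this game on $K_N$. *)

theory Defs
  imports Main
begin

text \<open>
  A graph is a pair of a vertex set and a set of edges, an edge being a set of two vertices.
\<close>

type_synonym 'a graph = "'a set \<times> 'a set set"

definition complete_graph :: "nat \<Rightarrow> nat graph" where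
  "complete_graph N = ({..<N}, {{u, v} |u v. u < N \<and> v < N \<and> u \<noteq> v})"

definition path_graph :: "nat \<Rightarrow> nat graph" where
  "path_graph n = ({..<n}, {{i, Suc i} |i. Suc i < n})"

text \<open>Copies are subgraphs, not necessarily induced.\<close>

definition contains_copy :: "'b graph \<Rightarrow> 'a graph \<Rightarrow> bool" where
  "contains_copy H G \<longleftrightarrow>
     (\<exists>f. inj_on f (fst G) \<and> f ` fst G \<subseteq> fst H \<and> (\<forall>e\<in>snd G. f ` e \<in> snd H))"

text \<open>
  The state of the game on \<open>K\<^sub>N\<close> is the list of the edges coloured so far, in chronological order.
  Alice moves first, so the blue edges are those at the (zero-based) even indices and the red
  edges are those at the odd indices.
\<close>

definition blue_graph :: "nat \<Rightarrow> nat set list \<Rightarrow> nat graph" where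
  "blue_graph N h = (fst (complete_graph N), {h ! i |i. i < length h \<and> even i})"

definition red_graph :: "nat \<Rightarrow> nat set list \<Rightarrow> nat graph" where
  "red_graph N h = (fst (complete_graph N), {h ! i |i. i < length h \<and> odd i})"

definition game_over :: "'a graph \<Rightarrow> nat \<Rightarrow> nat set list \<Rightarrow> bool" where
  "game_over G N h \<longleftrightarrow>
     contains_copy (blue_graph N h) G \<or> contains_copy (red_graph N h) G \<or>
     set h = snd (complete_graph N)"

definition legal_history :: "'a graph \<Rightarrow> nat \<Rightarrow> nat set list \<Rightarrow> bool" where
  "legal_history G N h \<longleftrightarrow>
     distinct h \<and> set h \<subseteq> snd (complete_graph N) \<and> (\<forall>k<length h. \<not> game_over G N (take k h))"

text \<open>A strategy of Alice maps each history with Alice to move to the edge she colours next.\<close>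

type_synonym strategy = "nat set list \<Rightarrow> nat set"

definition legal_strategy :: "'a graph \<Rightarrow> nat \<Rightarrow> strategy \<Rightarrow> bool" where
  "legal_strategy G N \<sigma> \<longleftrightarrow>
     (\<forall>h. legal_history G N h \<and> \<not> game_over G N h \<and> even (length h)
        \<longrightarrow> \<sigma> h \<in> snd (complete_graph N) - set h)"

definition follows :: "strategy \<Rightarrow> nat set list \<Rightarrow> bool" where
  "follows \<sigma> h \<longleftrightarrow> (\<forall>i<length h. even i \<longrightarrow> h ! i = \<sigma> (take i h))"

text \<open>
  A play stops as soon as one player has completed a copy of \<open>G\<close>. Hence, if \<open>G\<close> has an edge,
  a finished play with a blue copy of \<open>G\<close> has no red copy, and Alice was first to complete one.
\<close>

definition winning_strategy :: "'a graph \<Rightarrow> nat \<Rightarrow> strategy \<Rightarrow> bool" where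
  "winning_strategy G N \<sigma> \<longleftrightarrow>
     legal_strategy G N \<sigma> \<and>
     (\<forall>h. legal_history G N h \<and> game_over G N h \<and> follows \<sigma> h
        \<longrightarrow> contains_copy (blue_graph N h) G)"

text \<open>
  Intended for finite graphs without isolated vertices and with at least one edge.
\<close>

definition achievement_number :: "'a graph \<Rightarrow> nat" where
  "achievement_number G = (LEAST N. \<exists>\<sigma>. winning_strategy G N \<sigma>)"

end

theory Submission
  imports Defs "HOL-Library.Multiset"
begin

text \<open>
  For \<open>n \<ge> 5\<close> Alice builds a Hamiltonian path of \<open>K\<^sub>n\<close> in \<open>n - 1\<close> moves, so that Bob has no time to
  complete a path of his own. Her blue edges always form a linear forest, and only red edges that
  join ends of different components matter. As long as more than three vertices are isolated, she
  extends a single path so that at most one such red edge is left after her move, and this edge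
  meets an end of the path. With three isolated vertices left, she joins two of them after Bob's next
  move. The forest then consists of two paths and a vertex, with at most two red edges that matter,
  and a counting argument shows that she can afford any further answer of Bob.
\<close>

section \<open>Races\<close>

definition blue :: "'e list \<Rightarrow> 'e set" where
  "blue h = {h ! i |i. i < length h \<and> even i}"

definition red :: "'e list \<Rightarrow> 'e set" where
  "red h = {h ! i |i. i < length h \<and> odd i}"

lemma blue_Nil [simp]: "blue [] = {}" and red_Nil [simp]: "red [] = {}"
  by (auto simp: blue_def red_def)

lemma blue_image: "blue h = (!) h ` {i. i < length h \<and> even i}"
  and red_image: "red h = (!) h ` {i. i < length h \<and> odd i}"
  by (auto simp: blue_def red_def)

lemma blue_snoc: "blue (h @ [e]) = (if even (length h) then insert e (blue h) else blue h)"
proof -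
  have "{i. i < Suc (length h) \<and> even i} =
      (if even (length h) then {length h} else {}) \<union> {i. i < length h \<and> even i}"
    by (auto simp: less_Suc_eq)
  moreover have "(!) (h @ [e]) ` {i. i < length h \<and> even i} = blue h"
    unfolding blue_image by (rule image_cong) (simp_all add: nth_append)
  ultimately show ?thesis unfolding blue_image[of "h @ [e]"] by (simp add: image_Un)
qed

lemma red_snoc: "red (h @ [e]) = (if odd (length h) then insert e (red h) else red h)"
proof -
  have "{i. i < Suc (length h) \<and> odd i} =
      (if odd (length h) then {length h} else {}) \<union> {i. i < length h \<and> odd i}"
    by (auto simp: less_Suc_eq)
  moreover have "(!) (h @ [e]) ` {i. i < length h \<and> odd i} = red h"
    unfolding red_image by (rule image_cong) (simp_all add: nth_append)
  ultimately show ?thesis unfolding red_image[of "h @ [e]"] by (simp add: image_Un)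
qed

lemma blue_Un_red: "blue h \<union> red h = set h"
  by (auto simp: blue_def red_def in_set_conv_nth) blast

lemma blue_Int_red: "distinct h \<Longrightarrow> blue h \<inter> red h = {}"
  by (auto simp: blue_def red_def distinct_conv_nth)

lemma finite_red [simp]: "finite (red h)"
  by (metis blue_Un_red finite_Un finite_set)

lemma blue_take_subset: "blue (take k h) \<subseteq> blue h"
  by (auto simp: blue_def)

lemma card_red_le: "card (red h) \<le> length h div 2"
proof (induction h rule: rev_induct)
  case (snoc e h)
  have "card (insert e (red h)) \<le> Suc (card (red h))"
    by (simp add: card_insert_if)
  with snoc show ?case by (auto simp: red_snoc elim!: oddE)
qed simp

lemma blue_graph_eq: "blue_graph N h = ({..<N}, blue h)"
  and red_graph_eq: "red_graph N h = ({..<N}, red h)"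
  by (simp_all add: blue_graph_def red_graph_def blue_def red_def complete_graph_def)

lemma contains_copy_mono:
  "contains_copy (V, B) G \<Longrightarrow> B \<subseteq> B' \<Longrightarrow> contains_copy (V, B') G"
  unfolding contains_copy_def by fastforce

text \<open>
  Here the second player is to move. He may pass, which makes sure that the play does not end for
  lack of free edges; he may also recolour edges, which only helps him.
\<close>

primrec wins :: "'e set \<Rightarrow> ('e set \<Rightarrow> bool) \<Rightarrow> nat \<Rightarrow> 'e set \<Rightarrow> 'e set \<Rightarrow> bool" where
  "wins E T 0 B R = T B"
| "wins E T (Suc k) B R =
     (\<forall>R'. R' = R \<or> (\<exists>f. R' = insert f R) \<longrightarrow> (\<exists>e\<in>E - B - R'. wins E T k (insert e B) R'))"

text \<open>Alice follows the winning answers of the race. She needs \<open>k + 1\<close> moves in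
  all, and before the last of them Bob has coloured at most \<open>k\<close> edges, too few for a
  copy by \<open>slow\<close>. Hence only the race itself has to be analysed for each board.\<close>

lemma winning_strategy_if_wins:
  fixes G :: "'a graph" and N k :: nat
  defines "E \<equiv> snd (complete_graph N)" and "T \<equiv> \<lambda>B. contains_copy ({..<N}, B) G"
  assumes start: "e \<in> E" "wins E T k {e} {}"
    and slow: "\<And>R. finite R \<Longrightarrow> contains_copy ({..<N}, R) G \<Longrightarrow> k < card R"
  shows "\<exists>\<sigma>. winning_strategy G N \<sigma>"
proof -
  \<comment> \<open>On a history of even length, \<open>length h div 2\<close> of Alice's
    \<open>k + 1\<close> moves are made and \<open>e\<close> would be the next one; the difference
    counts the moves she still needs after \<open>e\<close>.\<close>
  define good where "good h e \<longleftrightarrow> e \<in> E - set h \<and>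
    wins E T (k - length h div 2) (insert e (blue h)) (red h)" for h e
  \<comment> \<open>The fallback to an arbitrary free edge matters only for legality, since
    histories off the winning line also need a move.\<close>
  define \<sigma> where "\<sigma> h = (if \<exists>e. good h e then SOME e. good h e else SOME e. e \<in> E - set h)" for h
  have good_\<sigma>: "good h (\<sigma> h)" if "good h e" for h e
  proof -
    have ex: "\<exists>e. good h e" using that by blast
    then have "good h (SOME e. good h e)" by (rule someI_ex)
    with ex show ?thesis by (simp add: \<sigma>_def)
  qed
  have "legal_strategy G N \<sigma>"
    unfolding legal_strategy_def
  proof (intro allI impI)
    fix h assume h: "legal_history G N h \<and> \<not> game_over G N h \<and> even (length h)"
    show "\<sigma> h \<in> snd (complete_graph N) - set h"
    proof (cases "\<exists>e. good h e")
      case True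
      then have "good h (\<sigma> h)" using good_\<sigma> by blast
      then show ?thesis by (simp add: good_def E_def)
    next
      case False
      have "\<exists>e. e \<in> E - set h"
        using h by (auto simp: legal_history_def game_over_def E_def)
      then have "(SOME e. e \<in> E - set h) \<in> E - set h"
        by (rule someI_ex)
      with False show ?thesis by (simp add: \<sigma>_def E_def)
    qed
  qed
  moreover have "contains_copy (blue_graph N h) G"
    if legal: "legal_history G N h" and over: "game_over G N h" and fol: "follows \<sigma> h" for h
  proof (rule ccontr)
    assume no: "\<not> contains_copy (blue_graph N h) G"
    have move: "wins E T (k - j) (blue (take (Suc (2 * j)) h)) (red (take (Suc (2 * j)) h))"
      if j: "2 * j < length h" and g: "good (take (2 * j) h) e" for j e
    proof -
      have "h ! (2 * j) = \<sigma> (take (2 * j) h)"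
        using fol j unfolding follows_def by simp
      with good_\<sigma>[OF g] j show ?thesis
        by (simp add: good_def take_Suc_conv_app_nth blue_snoc red_snoc)
    qed
    have inv: "\<exists>e. good (take (2 * j) h) e" if "2 * j \<le> length h" "j \<le> k" for j
      using that
    proof (induction j)
      case 0
      from start show ?case by (auto simp: good_def)
    next
      case (Suc j)
      then obtain e where "good (take (2 * j) h) e" by auto
      with Suc.prems have "wins E T (k - j) (blue (take (Suc (2 * j)) h)) (red (take (Suc (2 * j)) h))"
        by (intro move) auto
      moreover have "k - j = Suc (k - Suc j)" using Suc.prems by simp
      ultimately obtain e where
        "e \<in> E - blue (take (Suc (2 * j)) h) - insert (h ! Suc (2 * j)) (red (take (Suc (2 * j)) h))"
        "wins E T (k - Suc j) (insert e (blue (take (Suc (2 * j)) h)))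
           (insert (h ! Suc (2 * j)) (red (take (Suc (2 * j)) h)))"
        by auto
      moreover have "take (2 * Suc j) h = take (Suc (2 * j)) h @ [h ! Suc (2 * j)]"
        using Suc.prems by (simp add: take_Suc_conv_app_nth)
      ultimately have "good (take (2 * Suc j) h) e"
        using Suc.prems by (simp add: good_def blue_snoc red_snoc flip: blue_Un_red)
      then show ?case by blast
    qed
    \<comment> \<open>A longer play contains Alice's move number \<open>k + 1\<close>, after which
      the target is reached; later blue edges cannot destroy it.\<close>
    have short: "length h \<le> 2 * k"
    proof (rule ccontr)
      assume "\<not> length h \<le> 2 * k"
      with inv[of k] move[of k] have "T (blue (take (Suc (2 * k)) h))" by auto
      then have "contains_copy ({..<N}, blue h) G"
        unfolding T_def by (rule contains_copy_mono[OF _ blue_take_subset])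
      with no show False by (simp add: blue_graph_eq)
    qed
    with slow[of "red h"] card_red_le[of h] have "\<not> contains_copy (red_graph N h) G"
      by (fastforce simp: red_graph_eq)
    \<comment> \<open>With neither copy present, the board must be full. Both parities contradict
      this: before Alice's move a good edge is still free, and before Bob's move his option to pass
      yields a free edge.\<close>
    with over no have full: "set h = E" by (auto simp: game_over_def E_def)
    define j where "j = length h div 2"
    have "\<exists>e. good (take (2 * j) h) e" using inv[of j] short by (simp add: j_def)
    then obtain e where e: "good (take (2 * j) h) e" by blast
    show False
    proof (cases "even (length h)")
      case True
      with e full show False by (auto simp: j_def good_def)
    next
      case False
      then have len: "length h = Suc (2 * j)" by (auto simp: j_def elim: oddE)
      then have "wins E T (k - j) (blue h) (red h)" using move[OF _ e] by simp
      moreover have "k - j = Suc (k - j - 1)" using len short by simp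
      ultimately obtain e where "e \<in> E - blue h - red h" by (metis wins.simps(2))
      with full show False by (auto simp flip: blue_Un_red)
    qed
  qed
  ultimately show ?thesis unfolding winning_strategy_def by blast
qed

section \<open>Finished plays against an answering rule of Bob\<close>

lemma legal_history_snoc:
  assumes "legal_history G N h" "\<not> game_over G N h" "e \<in> snd (complete_graph N) - set h"
  shows "legal_history G N (h @ [e])"
  using assms by (auto simp: legal_history_def less_Suc_eq)

lemma finite_complete_graph: "finite (snd (complete_graph N))"
  by (rule finite_subset[of _ "Pow {..<N}"]) (auto simp: complete_graph_def)

text \<open>Bob refutes a strategy by answers that preserve an invariant \<open>I\<close>. Every
  round uses up two free edges, so the play ends. It may end right after a move of Alice; then only
  the history before that move is known to satisfy \<open>I\<close>, whence the last
  alternative.\<close>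

lemma exists_finished_play:
  assumes \<sigma>: "legal_strategy G N \<sigma>"
    and I0: "I []"
    and I: "\<And>h e. legal_history G N h \<Longrightarrow> I h \<Longrightarrow> even (length h) \<Longrightarrow> e \<in> snd (complete_graph N) - set h \<Longrightarrow>
       \<not> game_over G N (h @ [e]) \<Longrightarrow> \<exists>f\<in>snd (complete_graph N) - set (h @ [e]). I (h @ [e, f])"
  obtains h where "legal_history G N h" "game_over G N h" "follows \<sigma> h"
    "I h \<and> even (length h) \<or> (\<exists>g e. h = g @ [e] \<and> I g \<and> even (length g))"
proof -
  let ?E = "snd (complete_graph N)"
  have follows_snoc: "follows \<sigma> (h @ [e]) \<longleftrightarrow> follows \<sigma> h \<and> (even (length h) \<longrightarrow> e = \<sigma> h)" for h e
    by (auto simp: follows_def nth_append less_Suc_eq)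
  have "\<exists>h'. legal_history G N h' \<and> game_over G N h' \<and> follows \<sigma> h' \<and>
      (I h' \<and> even (length h') \<or> (\<exists>g e. h' = g @ [e] \<and> I g \<and> even (length g)))"
    if "legal_history G N h" "follows \<sigma> h" "I h" "even (length h)" for h
    using that
  proof (induction "card ?E - length h" arbitrary: h rule: less_induct)
    case less
    show ?case
    proof (cases "game_over G N h")
      case True
      with less.prems show ?thesis by blast
    next
      case False
      define e where "e = \<sigma> h"
      have e: "e \<in> ?E - set h"
        using \<sigma> less.prems False by (simp add: legal_strategy_def e_def)
      have he: "legal_history G N (h @ [e])" "follows \<sigma> (h @ [e])"
        using legal_history_snoc[OF less.prems(1) False e] less.prems by (auto simp: follows_snoc e_def)
      show ?thesis
      proof (cases "game_over G N (h @ [e])")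
        case True
        with he less.prems show ?thesis by blast
      next
        case over: False
        obtain f where f: "f \<in> ?E - set (h @ [e])" "I (h @ [e, f])"
          using I[OF less.prems(1,3,4) e over] by blast
        have hef: "legal_history G N (h @ [e, f])" "follows \<sigma> (h @ [e, f])"
          using legal_history_snoc[OF he(1) over f(1)] he(2) less.prems(4) follows_snoc[of "h @ [e]" f]
          by auto
        have "length (h @ [e, f]) \<le> card ?E"
          using hef(1) card_mono[OF finite_complete_graph, of "set (h @ [e, f])" N]
          by (simp only: legal_history_def distinct_card)
        then show ?thesis
          using less.hyps[OF _ hef f(2)] less.prems(4) by simp
      qed
    qed
  qed
  from this[of "[]"] I0 that show thesis
    by (auto simp: legal_history_def follows_def)
qed

section \<open>Linear forests\<close>

definition pairs :: "'a set \<Rightarrow> 'a set set" where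
  "pairs V = {{u, v} |u v. u \<in> V \<and> v \<in> V \<and> u \<noteq> v}"

lemma pairsI: "u \<in> V \<Longrightarrow> v \<in> V \<Longrightarrow> u \<noteq> v \<Longrightarrow> {u, v} \<in> pairs V"
  by (auto simp: pairs_def)

text \<open>Isolated vertices are one-element lists. The last conjunct says that no edge of
  \<open>B\<close> connects two different paths, which is what makes joining edges
  available.\<close>

definition path_forest :: "'a set \<Rightarrow> 'a set set \<Rightarrow> 'a list list \<Rightarrow> bool" where
  "path_forest V B ps \<longleftrightarrow>
     distinct (concat ps) \<and> set (concat ps) = V \<and> [] \<notin> set ps \<and>
     (\<forall>p\<in>set ps. successively (\<lambda>x y. {x, y} \<in> B) p) \<and> (\<forall>e\<in>B. \<exists>p\<in>set ps. e \<subseteq> set p)"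

text \<open>Both orders count because a path may be read backwards; an isolated vertex
  \<open>v\<close> has the ends \<open>(v, v)\<close>.\<close>

definition has_ends :: "'a list \<Rightarrow> 'a \<times> 'a \<Rightarrow> bool" where
  "has_ends p x \<longleftrightarrow> x = (hd p, last p) \<or> x = (last p, hd p)"

text \<open>Inner vertices are forgotten, since only ends can be used to join components.\<close>

definition forest_with_ends :: "'a set \<Rightarrow> 'a set set \<Rightarrow> ('a \<times> 'a) list \<Rightarrow> bool" where
  "forest_with_ends V B xs \<longleftrightarrow> (\<exists>ps. path_forest V B ps \<and> list_all2 has_ends ps xs)"

section \<open>Reordering, reversing and joining paths\<close>

lemma path_forest_permute:
  assumes "path_forest V B ps" "mset qs = mset ps"
  shows "path_forest V B qs"
proof -
  have "set qs = set ps" using assms(2) by (rule mset_eq_setD)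
  moreover have "mset (concat qs) = mset (concat ps)"
    using assms(2) by (metis mset_concat mset_map sum_mset_sum_list)
  then have "distinct (concat qs) = distinct (concat ps)" "set (concat qs) = set (concat ps)"
    by (metis mset_eq_imp_distinct_iff) (metis \<open>mset (concat qs) = mset (concat ps)\<close> mset_eq_setD)
  ultimately show ?thesis using assms(1) unfolding path_forest_def by simp
qed

text \<open>A reordering of the end pairs is carried back to the paths. This brings any two
  components to the front, where \<open>forest_join\<close> acts.\<close>

lemma forest_permute:
  assumes "forest_with_ends V B xs" "mset ys = mset xs"
  shows "forest_with_ends V B ys"
proof -
  obtain ps where ps: "path_forest V B ps" "list_all2 has_ends ps xs"
    using assms(1) by (auto simp: forest_with_ends_def)
  have "list_all2 (\<lambda>x p. has_ends p x) xs ps"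
    using ps(2) by (simp add: list_all2_conv_all_nth)
  then obtain qs where "list_all2 (\<lambda>x p. has_ends p x) ys qs" "mset qs = mset ps"
    using list_all2_reorder_left_invariance[OF _ assms(2)] by blast
  then have "list_all2 has_ends qs ys" "mset qs = mset ps"
    by (simp_all add: list_all2_conv_all_nth)
  then show ?thesis
    using path_forest_permute[OF ps(1)] by (auto simp: forest_with_ends_def)
qed

lemma forest_flip:
  "forest_with_ends V B ((a, b) # xs) \<Longrightarrow> forest_with_ends V B ((b, a) # xs)"
  by (auto simp: forest_with_ends_def list_all2_Cons2 has_ends_def)

lemma path_forest_rev:
  assumes "path_forest V B (p # ps)"
  shows "path_forest V B (rev p # ps)"
  using assms by (auto simp: path_forest_def insert_commute)

lemma path_forest_join:
  assumes "path_forest V B (p # q # ps)"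
  shows "path_forest V (insert {last p, hd q} B) ((p @ q) # ps)"
proof -
  define B' where "B' = insert {last p, hd q} B"
  have B': "{last p, hd q} \<in> B'" "\<And>e. e \<in> B' \<Longrightarrow> e = {last p, hd q} \<or> e \<in> B"
    by (auto simp: B'_def)
  have mono: "successively (\<lambda>x y. {x, y} \<in> B') r" if "successively (\<lambda>x y. {x, y} \<in> B) r" for r
    using that by (rule successively_mono) (auto simp: B'_def)
  have "\<exists>r\<in>set ((p @ q) # ps). e \<subseteq> set r" if "e \<in> B'" for e
    using B'(2)[OF that] assms by (fastforce simp: path_forest_def)
  with assms mono B'(1) have "path_forest V B' ((p @ q) # ps)"
    by (auto simp: path_forest_def successively_append_iff)
  then show ?thesis by (simp only: B'_def)
qed

lemma path_forest_orient:
  assumes "path_forest V B (p # ps)" "has_ends p (a, b)"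
  obtains p' where "path_forest V B (p' # ps)" "hd p' = a" "last p' = b"
proof (cases "hd p = a \<and> last p = b")
  case True
  with assms(1) that show thesis by blast
next
  case False
  then have "hd (rev p) = a" "last (rev p) = b"
    using assms by (auto simp: has_ends_def path_forest_def hd_rev last_rev)
  with path_forest_rev[OF assms(1)] that show thesis by blast
qed

lemma path_forest_swap: "path_forest V B (p # q # ps) \<Longrightarrow> path_forest V B (q # p # ps)"
  by (erule path_forest_permute) simp

text \<open>The effect of one move of Alice. Once both paths are oriented so that \<open>b\<close>
  is last and \<open>c\<close> is first, appending them gives the new path; an old edge
  \<open>{b, c}\<close> would have to lie inside a single path, but the two paths are
  disjoint.\<close>

lemma forest_join:
  assumes "forest_with_ends V B ((a, b) # (c, d) # xs)"
  shows "{b, c} \<in> pairs V - B" "forest_with_ends V (insert {b, c} B) ((a, d) # xs)"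
proof -
  obtain p q ps where "path_forest V B (p # q # ps)" "has_ends p (a, b)" "has_ends q (c, d)"
    and ps: "list_all2 has_ends ps xs"
    using assms by (auto simp: forest_with_ends_def list_all2_Cons2)
  then obtain p q where pq: "path_forest V B (p # q # ps)" "hd p = a" "last p = b" "hd q = c" "last q = d"
    by (metis path_forest_orient path_forest_swap)
  then have ne: "p \<noteq> []" "q \<noteq> []" by (auto simp: path_forest_def)
  then have mem: "b \<in> set p" "c \<in> set q" using pq by auto
  have disj: "set p \<inter> set q = {}" "\<And>r. r \<in> set ps \<Longrightarrow> set p \<inter> set r = {}"
    and V: "set p \<subseteq> V" "set q \<subseteq> V"
    using pq(1) by (auto simp: path_forest_def)
  have "{b, c} \<notin> B"
  proof
    assume "{b, c} \<in> B"
    then obtain r where "r \<in> set (p # q # ps)" "b \<in> set r" "c \<in> set r"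
      using pq(1) unfolding path_forest_def by (meson insert_subset)
    then show False using mem disj by auto
  qed
  moreover have "b \<noteq> c" "b \<in> V" "c \<in> V" using mem disj(1) V by auto
  ultimately show "{b, c} \<in> pairs V - B" by (auto simp: pairs_def)
  have "has_ends (p @ q) (a, d)" using pq ne by (auto simp: has_ends_def)
  then show "forest_with_ends V (insert {b, c} B) ((a, d) # xs)"
    using path_forest_join[OF pq(1)] pq ps unfolding forest_with_ends_def by blast
qed

lemma list_all2_right_witness:
  assumes "list_all2 P xs ys" "y \<in> set ys"
  shows "\<exists>x\<in>set xs. P x y"
  using assms by (induction rule: list_all2_induct) auto

text \<open>Different components are disjoint. The inequalities serve to show that the joining edges
  counted later are distinct.\<close>

lemma forest_ends_neq:
  assumes "forest_with_ends V B ((a, b) # xs)"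
  shows "list_all (\<lambda>(c, d). a \<noteq> c \<and> a \<noteq> d \<and> b \<noteq> c \<and> b \<noteq> d) xs"
proof -
  obtain p ps where p: "path_forest V B (p # ps)" "has_ends p (a, b)" "list_all2 has_ends ps xs"
    using assms by (auto simp: forest_with_ends_def list_all2_Cons2)
  have "a \<noteq> c \<and> a \<noteq> d \<and> b \<noteq> c \<and> b \<noteq> d" if cd: "(c, d) \<in> set xs" for c d
  proof -
    obtain q where q: "q \<in> set ps" "has_ends q (c, d)"
      using list_all2_right_witness[OF p(3) cd] by blast
    have ne: "p \<noteq> []" "q \<noteq> []" "set p \<inter> set q = {}"
      using p(1) q(1) by (auto simp: path_forest_def)
    then have "{a, b} \<subseteq> set p" "{c, d} \<subseteq> set q"
      using p(2) q(2) by (auto simp: has_ends_def)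
    with ne(3) show ?thesis by auto
  qed
  then show ?thesis by (auto simp: list_all_iff)
qed

lemma forest_of_vertices:
  assumes "distinct vs"
  shows "forest_with_ends (set vs) {} (map (\<lambda>v. (v, v)) vs)"
proof -
  have "concat (map (\<lambda>v. [v]) vs) = vs" by (induction vs) auto
  moreover have "list_all2 has_ends (map (\<lambda>v. [v]) vs) (map (\<lambda>v. (v, v)) vs)"
    by (simp add: list.rel_map list.rel_refl has_ends_def)
  ultimately show ?thesis
    using assms unfolding forest_with_ends_def path_forest_def by (intro exI[of _ "map (\<lambda>v. [v]) vs"]) auto
qed

section \<open>From a single component to a Hamiltonian path\<close>

lemma contains_path_copy:
  assumes "distinct p" "set p \<subseteq> V" "successively (\<lambda>x y. {x, y} \<in> B) p" "n \<le> length p"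
  shows "contains_copy (V, B) (path_graph n)"
  unfolding contains_copy_def
proof (intro exI[of _ "\<lambda>i. p ! i"] conjI ballI)
  show "inj_on (\<lambda>i. p ! i) (fst (path_graph n))"
    using assms by (auto simp: inj_on_def path_graph_def nth_eq_iff_index_eq)
  show "(\<lambda>i. p ! i) ` fst (path_graph n) \<subseteq> fst (V, B)"
    using assms by (auto simp: path_graph_def subset_iff)
  show "(\<lambda>i. p ! i) ` e \<in> snd (V, B)" if "e \<in> snd (path_graph n)" for e
    using that assms(3,4) by (auto simp: path_graph_def successively_conv_nth)
qed

lemma forest_single_path:
  assumes "forest_with_ends V B [x]"
  shows "contains_copy (V, B) (path_graph (card V))"
proof -
  obtain p where "path_forest V B [p]"
    using assms by (auto simp: forest_with_ends_def list_all2_Cons2)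
  then show ?thesis
    by (intro contains_path_copy[of p]) (auto simp: path_forest_def distinct_card)
qed

section \<open>Hamiltonian paths without a wasted move\<close>

abbreviation wins_ham :: "'a set \<Rightarrow> nat \<Rightarrow> 'a set set \<Rightarrow> 'a set set \<Rightarrow> bool" where
  "wins_ham V \<equiv> wins (pairs V) (\<lambda>B. contains_copy (V, B) (path_graph (card V)))"

text \<open>The edges form a list so that counts over explicit edges unfold by simplification. For
  distinct lists this is the number of red edges among them, and a move of Bob raises it by at most
  one.\<close>

definition hits :: "'e set \<Rightarrow> 'e list \<Rightarrow> nat" where
  "hits R es = length (filter (\<lambda>e. e \<in> R) es)"

lemma hits_Nil [simp]: "hits R [] = 0"
  and hits_Cons [simp]: "hits R (e # es) = of_bool (e \<in> R) + hits R es"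
  by (simp_all add: hits_def)

lemma hits_insert_notin: "f \<notin> set es \<Longrightarrow> hits (insert f R) es = hits R es"
  by (induction es) auto

lemma hits_insert: "distinct es \<Longrightarrow> hits (insert f R) es \<le> Suc (hits R es)"
  by (induction es) (auto simp: hits_insert_notin)

lemma hits_round:
  assumes "distinct es" "hits R es \<le> k" "R' = R \<or> (\<exists>f. R' = insert f R)"
  shows "hits R' es \<le> Suc k"
  using assms(3)
proof (elim disjE exE)
  fix f assume "R' = insert f R"
  with hits_insert[OF assms(1), of f R] assms(2) show ?thesis by simp
qed (use assms(2) in simp)

lemma wins_two_components:
  assumes F: "forest_with_ends V B [(a, b), (c, d)]"
    and "e \<noteq> f" "{e, f} \<subseteq> {{a, c}, {a, d}, {b, c}, {b, d}} - R"
  shows "wins_ham V 1 B R"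
proof -
  have join: "e \<in> pairs V - B \<and> contains_copy (V, insert e B) (path_graph (card V))"
    if "e \<in> {{a, c}, {a, d}, {b, c}, {b, d}}" for e
  proof -
    have swap: "forest_with_ends V B [(x, y), (d, c)]" if "forest_with_ends V B [(x, y), (c, d)]" for x y
    proof -
      have "forest_with_ends V B [(c, d), (x, y)]" using that by (rule forest_permute) simp
      then have "forest_with_ends V B [(d, c), (x, y)]" by (rule forest_flip)
      then show ?thesis by (rule forest_permute) simp
    qed
    \<comment> \<open>Reversing one or both paths brings each of the four edges into the position
      that \<open>forest_join\<close> colours.\<close>
    have "\<exists>x y z w. e = {y, z} \<and> forest_with_ends V B [(x, y), (z, w)]"
      using that F forest_flip[OF F] swap[OF F] swap[OF forest_flip[OF F]] by blast
    then obtain x y z w where e: "e = {y, z}" and F': "forest_with_ends V B [(x, y), (z, w)]" by blast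
    show ?thesis unfolding e using forest_join(1)[OF F'] forest_single_path[OF forest_join(2)[OF F']] by blast
  qed
  show ?thesis
    unfolding One_nat_def wins.simps
  proof (intro allI impI)
    fix R' assume "R' = R \<or> (\<exists>f. R' = insert f R)"
    then have "e \<notin> R' \<or> f \<notin> R'" using assms(2,3) by auto
    moreover have "{e, f} \<subseteq> {{a, c}, {a, d}, {b, c}, {b, d}}"
      using assms(3) by (rule Diff_subset[THEN subset_trans[rotated]])
    ultimately obtain g where g: "g \<notin> R'" "g \<in> {{a, c}, {a, d}, {b, c}, {b, d}}" by (elim disjE) simp_all
    show "\<exists>e\<in>pairs V - B - R'. contains_copy (V, insert e B) (path_graph (card V))"
      using join[OF g(2)] g(1) by (intro bexI[of _ g] DiffI) (elim conjE DiffE; assumption)+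
  qed
qed

text \<open>Alice attaches \<open>z\<close> to an end of one path so that two of the four remaining
  joining edges are free. As \<open>a \<noteq> b\<close> and \<open>c \<noteq> d\<close>, the eight
  listed edges are distinct, so at most three of them are red after Bob's move.\<close>

lemma wins_two_paths_and_vertex:
  assumes F: "forest_with_ends V B [(a, b), (c, d), (z, z)]" and "a \<noteq> b" "c \<noteq> d"
    and R: "hits R [{a, c}, {a, d}, {b, c}, {b, d}, {a, z}, {b, z}, {c, z}, {d, z}] \<le> 2"
  shows "wins_ham V 2 B R"
  unfolding numeral_2_eq_2 wins.simps(2)[of _ _ "Suc 0"]
proof (intro allI impI)
  fix R' assume R': "R' = R \<or> (\<exists>f. R' = insert f R)"
  have F': "forest_with_ends V B [(c, d), (a, b), (z, z)]"
    using F by (rule forest_permute) simp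
  have neq: "a \<noteq> c" "a \<noteq> d" "b \<noteq> c" "b \<noteq> d" "a \<noteq> z" "b \<noteq> z" "c \<noteq> z" "d \<noteq> z"
    using forest_ends_neq[OF F] forest_ends_neq[OF F'] by simp_all
  have h3: "hits R' [{a, c}, {a, d}, {b, c}, {b, d}, {a, z}, {b, z}, {c, z}, {d, z}] \<le> 3"
    using hits_round[OF _ R R'] neq assms(2,3) by (simp add: doubleton_eq_iff)
  \<comment> \<open>Attaching \<open>z\<close> at \<open>y\<close> leaves a path from
    \<open>x\<close> to \<open>z\<close> and one from \<open>u\<close> to \<open>v\<close>. The
    edges in \<open>h\<close> are the ways to join them, and at most two red ones leave two
    free.\<close>
  have join: "\<exists>e\<in>pairs V - B - R'. wins_ham V (Suc 0) (insert e B) R'"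
    if F: "forest_with_ends V B [(x, y), (u, v), (z, z)]" and neq: "x \<noteq> y" "u \<noteq> v" "x \<noteq> z"
      and "{y, z} \<notin> R'" and h: "hits R' [{x, u}, {x, v}, {u, z}, {v, z}] \<le> 2"
    for x y u v
  proof -
    have F1: "forest_with_ends V B [(x, y), (z, z), (u, v)]"
      using F by (rule forest_permute) simp
    note F2 = forest_join[OF F1]
    have n: "x \<noteq> u" "x \<noteq> v" "z \<noteq> u" "z \<noteq> v"
      using forest_ends_neq[OF F2(2)] by simp_all
    have "\<exists>e f. e \<noteq> f \<and> {e, f} \<subseteq> {{x, u}, {x, v}, {z, u}, {z, v}} - R'"
    proof -
      define es where "es = [{x, u}, {x, v}, {u, z}, {v, z}]"
      have "distinct es" using n neq by (simp add: es_def doubleton_eq_iff)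
      have "2 \<le> length (filter (\<lambda>e. e \<notin> R') es)"
        using h sum_length_filter_compl[of "\<lambda>e. e \<in> R'" es] by (simp add: hits_def es_def)
      then obtain e f r where r: "filter (\<lambda>e. e \<notin> R') es = e # f # r"
        by (metis One_nat_def Suc_1 Suc_le_length_iff)
      then have "e \<noteq> f" using distinct_filter[OF \<open>distinct es\<close>, of "\<lambda>e. e \<notin> R'"] by auto
      moreover have "{u, z} = {z, u}" "{v, z} = {z, v}" by auto
      then have "set (filter (\<lambda>e. e \<notin> R') es) = {{x, u}, {x, v}, {z, u}, {z, v}} - R'"
        by (simp only: set_filter es_def list.set set_diff_eq)
      then have "{e, f} \<subseteq> {{x, u}, {x, v}, {z, u}, {z, v}} - R'"
        unfolding r by (metis empty_subsetI insert_subset list.set_intros)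
      ultimately show ?thesis by (intro exI conjI)
    qed
    then obtain e f where "e \<noteq> f" "{e, f} \<subseteq> {{x, u}, {x, v}, {z, u}, {z, v}} - R'" by (elim exE conjE)
    then have "wins_ham V 1 (insert {y, z} B) R'"
      by (rule wins_two_components[OF F2(2)])
    with F2(1) \<open>{y, z} \<notin> R'\<close> show ?thesis unfolding One_nat_def by blast
  qed
  \<comment> \<open>If exactly one of the two edges from \<open>z\<close> to the ends of some path
    is red, attaching \<open>z\<close> at the other end of that path discards the red one. If no
    edge at \<open>z\<close> is red, every end works, because only two edges between the paths
    survive. Otherwise both edges from \<open>z\<close> to one path are red; a third red edge then
    runs between the paths, and \<open>z\<close> is attached to the other path, at the end which
    that edge meets.\<close>
  have "{a, z} \<notin> R' \<and> hits R' [{b, c}, {b, d}, {c, z}, {d, z}] \<le> 2 \<or>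
        {b, z} \<notin> R' \<and> hits R' [{a, c}, {a, d}, {c, z}, {d, z}] \<le> 2 \<or>
        {c, z} \<notin> R' \<and> hits R' [{d, a}, {d, b}, {a, z}, {b, z}] \<le> 2 \<or>
        {d, z} \<notin> R' \<and> hits R' [{c, a}, {c, b}, {a, z}, {b, z}] \<le> 2"
  proof -
    have "{d, a} = {a, d}" "{d, b} = {b, d}" "{c, a} = {a, c}" "{c, b} = {b, c}" by auto
    then show ?thesis using h3
      by (cases "{a, z} \<in> R'"; cases "{b, z} \<in> R'"; cases "{c, z} \<in> R'"; cases "{d, z} \<in> R'")
        (auto simp: of_bool_def split: if_splits)
  qed
  then show "\<exists>e\<in>pairs V - B - R'. wins_ham V (Suc 0) (insert e B) R'"
  proof (elim disjE conjE)
    assume "{a, z} \<notin> R'" "hits R' [{b, c}, {b, d}, {c, z}, {d, z}] \<le> 2"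
    then show ?thesis using neq assms(2,3) by (intro join[OF forest_flip[OF F]]) auto
  next
    assume "{b, z} \<notin> R'" "hits R' [{a, c}, {a, d}, {c, z}, {d, z}] \<le> 2"
    then show ?thesis using neq assms(2,3) by (intro join[OF F]) auto
  next
    assume "{c, z} \<notin> R'" "hits R' [{d, a}, {d, b}, {a, z}, {b, z}] \<le> 2"
    then show ?thesis using neq assms(2,3) by (intro join[OF forest_flip[OF F']]) auto
  next
    assume "{d, z} \<notin> R'" "hits R' [{c, a}, {c, b}, {a, z}, {b, z}] \<le> 2"
    then show ?thesis using neq assms(2,3) by (intro join[OF F']) auto
  qed
qed

text \<open>After Bob's move at most two of the nine edges are red, so one of the three edges on
  \<open>u\<close>, \<open>v\<close>, \<open>w\<close> is free. Colouring it leaves the eight edges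
  of \<open>wins_two_paths_and_vertex\<close>, with at most two red.\<close>

lemma wins_path_and_three_vertices:
  assumes F: "forest_with_ends V B [(a, b), (u, u), (v, v), (w, w)]" and "a \<noteq> b"
    and R: "hits R [{a, u}, {a, v}, {a, w}, {b, u}, {b, v}, {b, w}, {u, v}, {u, w}, {v, w}] \<le> 1"
  shows "wins_ham V 3 B R"
  unfolding numeral_3_eq_3 wins.simps(2)[of _ _ "Suc (Suc 0)"]
proof (intro allI impI)
  fix R' assume R': "R' = R \<or> (\<exists>f. R' = insert f R)"
  have perm: "forest_with_ends V B ps" if "mset ps = mset [(a, b), (u, u), (v, v), (w, w)]" for ps
    using F that by (rule forest_permute)
  have neq: "a \<noteq> u" "a \<noteq> v" "a \<noteq> w" "b \<noteq> u" "b \<noteq> v" "b \<noteq> w" "u \<noteq> v" "u \<noteq> w" "v \<noteq> w"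
    using forest_ends_neq[OF F] forest_ends_neq[OF perm[of "[(u, u), (v, v), (w, w), (a, b)]"]]
      forest_ends_neq[OF perm[of "[(v, v), (w, w), (a, b), (u, u)]"]] by simp_all
  have h2: "hits R' [{a, u}, {a, v}, {a, w}, {b, u}, {b, v}, {b, w}, {u, v}, {u, w}, {v, w}] \<le> 2"
    using hits_round[OF _ R R'] neq assms(2) by (simp add: doubleton_eq_iff)
  have join: "\<exists>e\<in>pairs V - B - R'. wins_ham V (Suc (Suc 0)) (insert e B) R'"
    if F: "forest_with_ends V B [(x, x), (y, y), (a, b), (z, z)]" and xy: "x \<noteq> y" "{x, y} \<notin> R'"
      and h: "hits R' [{a, x}, {a, y}, {b, x}, {b, y}, {a, z}, {b, z}, {x, z}, {y, z}] \<le> 2"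
    for x y z
  proof -
    note F2 = forest_join[OF F]
    have "forest_with_ends V (insert {x, y} B) [(a, b), (x, y), (z, z)]"
      using F2(2) by (rule forest_permute) simp
    then have "wins_ham V 2 (insert {x, y} B) R'"
      using assms(2) xy(1) h by (rule wins_two_paths_and_vertex)
    with F2(1) xy(2) show ?thesis unfolding numeral_2_eq_2 by blast
  qed
  have comm: "{w, v} = {v, w}" "{w, u} = {u, w}" "{v, u} = {u, v}" by auto
  have "{u, v} \<notin> R' \<or> {u, w} \<notin> R' \<or> {v, w} \<notin> R'"
    using h2 by (auto split: if_splits)
  then show "\<exists>e\<in>pairs V - B - R'. wins_ham V (Suc (Suc 0)) (insert e B) R'"
  proof (elim disjE)
    assume "{u, v} \<notin> R'"
    with h2 neq show ?thesis
      by (intro join[OF perm, of u v w]) (simp_all add: comm)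
  next
    assume "{u, w} \<notin> R'"
    with h2 neq show ?thesis
      by (intro join[OF perm, of u w v]) (simp_all add: comm)
  next
    assume "{v, w} \<notin> R'"
    with h2 neq show ?thesis
      by (intro join[OF perm, of v w u]) (simp_all add: comm)
  qed
qed

text \<open>
  Red edges at inner vertices of the path or between its ends do not matter. Extending the path at
  the end that carries the old red edge disposes of it, so only the new red edge remains.
\<close>

lemma wins_path_and_vertices:
  assumes "forest_with_ends V B ((a, b) # map (\<lambda>x. (x, x)) us)" "a \<noteq> b" "length us = m + 3" "distinct us"
    and "\<And>x w. x \<in> insert a (insert b (set us)) \<Longrightarrow> w \<in> set us \<Longrightarrow> x \<noteq> w \<Longrightarrow> {x, w} \<in> R \<Longrightarrow> {x, w} = {a, y}"
  shows "wins_ham V (m + 3) B R"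
  using assms
proof (induction m arbitrary: a b y us B R)
  case 0
  then obtain u v w where us: "us = [u, v, w]"
    by (auto simp: numeral_3_eq_3 length_Suc_conv)
  have F: "forest_with_ends V B [(a, b), (u, u), (v, v), (w, w)]"
    using "0.prems"(1) by (simp add: us)
  have perm: "forest_with_ends V B ps" if "mset ps = mset [(a, b), (u, u), (v, v), (w, w)]" for ps
    using F that by (rule forest_permute)
  have neq: "a \<noteq> u" "a \<noteq> v" "a \<noteq> w" "b \<noteq> u" "b \<noteq> v" "b \<noteq> w" "u \<noteq> v" "u \<noteq> w" "v \<noteq> w"
    using forest_ends_neq[OF F] forest_ends_neq[OF perm[of "[(u, u), (v, v), (w, w), (a, b)]"]]
      forest_ends_neq[OF perm[of "[(v, v), (w, w), (a, b), (u, u)]"]] by simp_all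
  define es where "es = [{a, u}, {a, v}, {a, w}, {b, u}, {b, v}, {b, w}, {u, v}, {u, w}, {v, w}]"
  have "distinct es" using neq "0.prems"(2) by (simp add: es_def doubleton_eq_iff)
  moreover have "set (filter (\<lambda>e. e \<in> R) es) \<subseteq> {{a, y}}"
    using "0.prems"(5) neq by (auto simp: es_def us)
  ultimately have "hits R es \<le> 1"
    unfolding hits_def
    by (metis card_mono[of "{{a, y}}"] distinct_card distinct_filter finite.emptyI finite_insert
        is_singletonI is_singleton_altdef)
  then show ?case
    using wins_path_and_three_vertices[OF F "0.prems"(2)] by (simp add: es_def)
next
  case (Suc m)
  note F = Suc.prems(1) and red = Suc.prems(5)
  have notin: "a \<notin> set us" "b \<notin> set us"
    using forest_ends_neq[OF F] by (auto simp: list.pred_map list_all_iff)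
  from \<open>distinct us\<close> have card: "card (set us) = m + 4" using Suc.prems(3) by (simp add: distinct_card)
  have "\<exists>e\<in>pairs V - B - R'. wins_ham V (m + 3) (insert e B) R'"
    if R': "R' = R \<or> (\<exists>f. R' = insert f R)" for R'
  proof -
    \<comment> \<open>This form also covers a pass, with an arbitrary \<open>f\<close>.\<close>
    obtain f where f: "R' \<subseteq> insert f R"
      using R' by auto
    have red': "{x, w} = {a, y} \<or> {x, w} = f"
      if "x \<in> insert a (insert b (set us))" "w \<in> set us" "x \<noteq> w" "{x, w} \<in> R'" for x w
      using that red f by blast
    \<comment> \<open>The path is extended from \<open>a\<close> to \<open>x\<close>. If Bob's edge
      joins two isolated vertices, one of its ends different from \<open>y\<close> is taken, so that
      this edge will meet the new end of the path. Otherwise at most two of at least four isolated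
      vertices are blocked.\<close>
    have "\<exists>x\<in>set us. {a, x} \<notin> R' \<and> (f \<subseteq> set us \<longrightarrow> x \<in> f \<or> card f \<noteq> 2)"
    proof (cases "f \<subseteq> set us \<and> card f = 2")
      case True
      then obtain s t where "f = {s, t}" "s \<noteq> t" by (auto simp: card_2_iff)
      then obtain x where "x \<in> f" "x \<noteq> y" by auto
      with True notin red'[of a x] show ?thesis by (auto simp: doubleton_eq_iff)
    next
      case False
      have "\<not> set us \<subseteq> {x. {a, x} = {a, y} \<or> {a, x} = f}"
      proof
        assume sub: "set us \<subseteq> {x. {a, x} = {a, y} \<or> {a, x} = f}"
        \<comment> \<open>The description denotes the other end of \<open>f\<close> if
          \<open>f\<close> joins \<open>a\<close> to a vertex, and is a junk value otherwise; either
          way the bound of two blocked vertices holds.\<close>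
        have "set us \<subseteq> {y, THE x. {a, x} = f}"
        proof
          fix x assume "x \<in> set us"
          with sub have "x = y \<or> {a, x} = f" by (auto simp: doubleton_eq_iff)
          moreover have "(THE x. {a, x} = f) = x" if "{a, x} = f"
            using that by (intro the_equality) (auto simp: doubleton_eq_iff)
          ultimately show "x \<in> {y, THE x. {a, x} = f}" by auto
        qed
        then have "card (set us) \<le> card {y, THE x. {a, x} = f}" by (rule card_mono[rotated]) simp
        also have "\<dots> \<le> 2" by (simp add: card_insert_if)
        finally show False using card by simp
      qed
      then obtain x where "x \<in> set us" "{a, x} \<noteq> {a, y}" "{a, x} \<noteq> f" by blast
      with red'[of a x] notin False show ?thesis by auto
    qed
    then obtain x where x: "x \<in> set us" "{a, x} \<notin> R'" "f \<subseteq> set us \<longrightarrow> x \<in> f \<or> card f \<noteq> 2"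
      by blast
    define us' where "us' = remove1 x us"
    have us': "mset us = mset (x # us')" "set us' = set us - {x}" "length us' = m + 3" "distinct us'"
      using x(1) \<open>distinct us\<close> Suc.prems(3) by (auto simp: us'_def length_remove1 distinct_remove1)
    have "mset (map (\<lambda>x. (x, x)) us) = mset ((x, x) # map (\<lambda>x. (x, x)) us')"
      using us'(1) by simp
    then have F': "forest_with_ends V B ((b, a) # (x, x) # map (\<lambda>x. (x, x)) us')"
      by (intro forest_permute[OF forest_flip[OF F]]) simp
    note F2 = forest_join[OF F']
    have bx: "b \<noteq> x" using notin x(1) by auto
    have ends: "insert b (insert x (set us')) \<subseteq> insert b (set us)"
      "insert x (insert b (set us')) = insert b (insert x (set us'))"
      using us'(2) x(1) by auto
    \<comment> \<open>The vertex \<open>a\<close> is now inside the path or no longer an end, so the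
      old red edge \<open>{a, y}\<close> has lost its effect.\<close>
    have red2: "{s, t} = f"
      if "s \<in> insert b (insert x (set us'))" "t \<in> set us'" "s \<noteq> t" "{s, t} \<in> R'" for s t
    proof -
      have st: "s \<in> insert b (set us)" "t \<in> set us" using that ends(1) us'(2) by auto
      then have "{s, t} = {a, y} \<or> {s, t} = f" using that(3,4) by (intro red') auto
      moreover have "a \<notin> {s, t}" using st notin Suc.prems(2) by auto
      ultimately show ?thesis by auto
    qed
    have "wins_ham V (m + 3) (insert {a, x} B) R'"
    \<comment> \<open>The induction hypothesis wants the red edge at the first listed end: this is
      \<open>x\<close> or \<open>b\<close>, according to which of them \<open>f\<close> meets. If
      \<open>f\<close> meets neither, the choice of \<open>x\<close> shows that no red edge matters,
      and any \<open>y\<close> will do.\<close>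
    proof (cases "\<exists>z. f = {x, z}")
      case True
      then obtain z where "f = {x, z}" by blast
      with red2 show ?thesis
        by (intro Suc.IH[OF forest_flip[OF F2(2)] bx[symmetric] us'(3,4), of _ z]) (simp only: ends(2))
    next
      case nx: False
      show ?thesis
      proof (cases "\<exists>z. f = {b, z}")
        case True
        then obtain z where "f = {b, z}" by blast
        with red2 show ?thesis
          by (intro Suc.IH[OF F2(2) bx us'(3,4), of _ z]) simp
      next
        case nb: False
        have "{s, t} \<notin> R'" if st: "s \<in> insert b (insert x (set us'))" "t \<in> set us'" "s \<noteq> t" for s t
        proof
          assume "{s, t} \<in> R'"
          with st have f: "f = {s, t}" using red2 by blast
          with nb nx st have "s \<in> set us'" "x \<notin> f" by auto
          with x(3) f st us'(2) show False by auto
        qed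
        then show ?thesis
          by (intro Suc.IH[OF F2(2) bx us'(3,4), of _ y]) blast
      qed
    qed
    with F2(1) x(2) show ?thesis by blast
  qed
  then show ?case unfolding add_Suc wins.simps by blast
qed

section \<open>Achievement numbers of paths\<close>

lemma complete_graph_pairs: "snd (complete_graph N) = pairs {..<N}"
  by (auto simp: complete_graph_def pairs_def)

lemma path_copyE:
  assumes "contains_copy (V, B) (path_graph n)"
  obtains f where "inj_on f {..<n}" "f ` {..<n} \<subseteq> V" "\<And>i. Suc i < n \<Longrightarrow> {f i, f (Suc i)} \<in> B"
proof -
  obtain f where f: "inj_on f {..<n}" "f ` {..<n} \<subseteq> V" "\<forall>e\<in>{{i, Suc i} |i. Suc i < n}. f ` e \<in> B"
    using assms unfolding contains_copy_def path_graph_def fst_conv snd_conv by (elim exE conjE)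
  have "{f i, f (Suc i)} \<in> B" if "Suc i < n" for i
    using bspec[OF f(3), of "{i, Suc i}"] that by auto
  with f that show thesis by blast
qed

lemma path_copy_card:
  assumes "contains_copy (V, R) (path_graph n)" "finite R"
  shows "n - 1 \<le> card R"
proof -
  obtain f where f: "inj_on f {..<n}" "\<And>i. Suc i < n \<Longrightarrow> {f i, f (Suc i)} \<in> R"
    using path_copyE[OF assms(1)] by metis
  have "inj_on (\<lambda>i. {f i, f (Suc i)}) {..<n - 1}"
  proof (rule inj_onI)
    fix i j assume ij: "i \<in> {..<n - 1}" "j \<in> {..<n - 1}" "{f i, f (Suc i)} = {f j, f (Suc j)}"
    have "f ` {i, Suc i} = f ` {j, Suc j}" using ij(3) by simp
    then have "{i, Suc i} = {j, Suc j}"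
      by (rule inj_on_image_eq_iff[OF f(1), THEN iffD1, rotated 2]) (use ij in auto)
    then show "i = j" by (auto simp: doubleton_eq_iff)
  qed
  moreover have "(\<lambda>i. {f i, f (Suc i)}) ` {..<n - 1} \<subseteq> R"
    using f(2) by auto
  ultimately show ?thesis
    using card_inj_on_le[OF _ _ assms(2), of _ "{..<n - 1}"] by (metis card_lessThan)
qed

lemma path_copy_card_vertices:
  assumes "contains_copy ({..<N}, R) (path_graph n)"
  shows "n \<le> N"
proof -
  obtain f where "inj_on f {..<n}" "f ` {..<n} \<subseteq> {..<N}"
    using path_copyE[OF assms] by metis
  from card_inj_on_le[OF this] show ?thesis by simp
qed

text \<open>The path has \<open>n - 1\<close> edges. After the opening \<open>e\<close> Alice uses
  \<open>n - 2\<close> further moves, one fewer than the red edges Bob would need.\<close>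

lemma winning_strategy_path:
  assumes "n \<ge> 2" "e \<in> pairs {..<N}"
    and "wins (pairs {..<N}) (\<lambda>B. contains_copy ({..<N}, B) (path_graph n)) (n - 2) {e} {}"
  shows "\<exists>\<sigma>. winning_strategy (path_graph n) N \<sigma>"
proof (rule winning_strategy_if_wins[where e = e and k = "n - 2"])
  show "n - 2 < card R" if "finite R" "contains_copy ({..<N}, R) (path_graph n)" for R
    using path_copy_card[OF that(2,1)] assms(1) by linarith
qed (use assms in \<open>simp_all add: complete_graph_pairs\<close>)

text \<open>Alice opens with \<open>{0, 1}\<close>, leaving \<open>N - 1\<close> components and
  hence \<open>N - 2\<close> joins to a Hamiltonian path.\<close>

lemma forest_after_first_move:
  assumes "N \<ge> 2"
  shows "forest_with_ends {..<N} {{0, 1}} ((0, 1) # map (\<lambda>v. (v, v)) [2..<N])"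
    and "{0, 1} \<in> pairs {..<N}"
proof -
  have "[0..<N] = 0 # 1 # [2..<N]"
    using assms by (simp add: upt_conv_Cons numeral_2_eq_2)
  moreover have "forest_with_ends {..<N} {} (map (\<lambda>v. (v, v)) [0..<N])"
    using forest_of_vertices[of "[0..<N]"] by (simp add: atLeast0LessThan)
  ultimately have "forest_with_ends {..<N} {} ((0, 0) # (1, 1) # map (\<lambda>v. (v, v)) [2..<N])"
    by simp
  from forest_join[OF this] show "forest_with_ends {..<N} {{0, 1}} ((0, 1) # map (\<lambda>v. (v, v)) [2..<N])"
    "{0, 1} \<in> pairs {..<N}" by auto
qed

section \<open>Boards on which Alice wins\<close>

lemma Alice_wins_ham_path:
  assumes "n \<ge> 5"
  shows "\<exists>\<sigma>. winning_strategy (path_graph n) n \<sigma>"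
proof (rule winning_strategy_path)
  have "wins_ham {..<n} (n - 5 + 3) {{0, 1}} {}"
    using assms forest_after_first_move(1)[of n]
    \<comment> \<open>No edge is red yet, so the vertex \<open>y\<close> may be
      \<open>undefined\<close>. The \<open>n - 2\<close> isolated vertices have the form
      \<open>m + 3\<close> with \<open>m = n - 5\<close>, which is where \<open>n \<ge> 5\<close>
      enters.\<close>
    by (intro wins_path_and_vertices[of _ _ 0 1 "[2..<n]" _ _ undefined]) simp_all
  moreover have "n - 5 + 3 = n - 2" using assms by simp
  ultimately show "wins (pairs {..<n}) (\<lambda>B. contains_copy ({..<n}, B) (path_graph n)) (n - 2) {{0, 1}} {}"
    by simp
qed (use assms forest_after_first_move(2)[of n] in auto)

lemma Alice_wins_P3: "\<exists>\<sigma>. winning_strategy (path_graph 3) 3 \<sigma>"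
proof (rule winning_strategy_path)
  have "forest_with_ends {..<3::nat} {{0, 1}} [(0, 1), (2, 2)]"
    using forest_after_first_move(1)[of 3] by (simp add: upt_conv_Cons)
  then have "wins_ham {..<3::nat} 1 {{0, 1}} {}"
    by (rule wins_two_components[where e = "{0, 2}" and f = "{1, 2}"]) (auto simp: doubleton_eq_iff)
  moreover have "card {..<3::nat} = 3" "3 - 2 = (1::nat)" by simp_all
  ultimately show
    "wins (pairs {..<3::nat}) (\<lambda>B. contains_copy ({..<3}, B) (path_graph 3)) (3 - 2) {{0, 1}} {}"
    by (simp only:)
qed (use forest_after_first_move(2)[of 3] in auto)

text \<open>The fifth vertex gives room for enough threats. Alice extends \<open>{0, 1}\<close> by a
  free edge \<open>{1, x}\<close>; the path 0, 1, \<open>x\<close> can then be completed by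
  \<open>{0, y}\<close>, \<open>{0, z}\<close> or \<open>{x, y}\<close>, while Bob owns at most two
  edges.\<close>

lemma Alice_wins_P4: "\<exists>\<sigma>. winning_strategy (path_graph 4) 5 \<sigma>"
proof (rule winning_strategy_path)
  let ?T = "\<lambda>B. contains_copy ({..<5::nat}, B) (path_graph 4)"
  have path: "?T B" if "distinct [a, b, c, d]" "{a, b, c, d} \<subseteq> {..<5}" "{a, b} \<in> B" "{b, c} \<in> B" "{c, d} \<in> B"
    for a b c d :: nat and B
    using that by (intro contains_path_copy[of "[a, b, c, d]"]) auto
  show "wins (pairs {..<5::nat}) ?T (4 - 2) {{0, 1}} {}"
  proof -
    have round: "\<exists>e\<in>pairs {..<5} - {{0, 1}} - R. wins (pairs {..<5}) ?T (Suc 0) (insert e {{0, 1}}) R"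
      if R: "R = {} \<or> (\<exists>f. R = insert f {})" for R :: "nat set set"
    proof -
      \<comment> \<open>Bob's single edge cannot be both \<open>{1, 2}\<close> and
        \<open>{1, 3}\<close>, so \<open>x\<close> can be 2 or 3.\<close>
      obtain x y z where x: "{x, y, z} = {2, 3, 4::nat}" "x \<noteq> y" "x \<noteq> z" "y \<noteq> z" "{1, x} \<notin> R"
      proof (cases "{1, 2} \<in> R")
        case True
        with R have "{1, 3} \<notin> R" by (auto simp: doubleton_eq_iff)
        then show thesis by (intro that[of 3 2 4]) auto
      next
        case False
        then show thesis by (intro that[of 2 3 4]) auto
      qed
      have "{x, y, z} \<subseteq> {2..4}" unfolding x(1) by simp
      then have range: "1 < x" "x < 5" "1 < y" "y < 5" "1 < z" "z < 5"
        by simp_all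
      have step: "\<exists>e\<in>pairs {..<5} - {{1, x}, {0, 1}} - R'. ?T (insert e {{1, x}, {0, 1}})"
        if R': "R' = R \<or> (\<exists>f. R' = insert f R)" for R'
      proof -
        have "distinct [{0, y}, {0, z}, {x, y}]"
          using x(2-4) range by (auto simp: doubleton_eq_iff)
        then have "{0, y} \<notin> R' \<or> {0, z} \<notin> R' \<or> {x, y} \<notin> R'"
          using R R' by (elim disjE exE; simp; metis)
        then show ?thesis
        proof (elim disjE)
          assume free: "{0, y} \<notin> R'"
          show ?thesis
          proof (rule bexI[OF _ DiffI])
            show "?T (insert {0, y} {{1, x}, {0, 1}})"
              using x range by (intro path[of y 0 1 x]) (auto simp: insert_commute)
            show "{0, y} \<in> pairs {..<5} - {{1, x}, {0, 1}}"
              using x range by (auto simp: doubleton_eq_iff intro: pairsI)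
            show "{0, y} \<notin> R'" by (rule free)
          qed
        next
          assume free: "{0, z} \<notin> R'"
          show ?thesis
          proof (rule bexI[OF _ DiffI])
            show "?T (insert {0, z} {{1, x}, {0, 1}})"
              using x range by (intro path[of z 0 1 x]) (auto simp: insert_commute)
            show "{0, z} \<in> pairs {..<5} - {{1, x}, {0, 1}}"
              using x range by (auto simp: doubleton_eq_iff intro: pairsI)
            show "{0, z} \<notin> R'" by (rule free)
          qed
        next
          assume free: "{x, y} \<notin> R'"
          show ?thesis
          proof (rule bexI[OF _ DiffI])
            show "?T (insert {x, y} {{1, x}, {0, 1}})"
              using x range by (intro path[of 0 1 x y]) auto
            show "{x, y} \<in> pairs {..<5} - {{1, x}, {0, 1}}"
              using x range by (auto simp: doubleton_eq_iff intro: pairsI)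
            show "{x, y} \<notin> R'" by (rule free)
          qed
        qed
      qed
      have "wins (pairs {..<5}) ?T (Suc 0) (insert {1, x} {{0, 1}}) R"
        unfolding wins.simps by (intro allI impI) (rule step)
      moreover have "{1, x} \<in> pairs {..<5} - {{0, 1}} - R"
        using x(5) range by (auto simp: doubleton_eq_iff intro: pairsI)
      ultimately show ?thesis by (rule bexI)
    qed
    have "4 - 2 = Suc (Suc 0)" by simp
    then show ?thesis
      unfolding \<open>4 - 2 = Suc (Suc 0)\<close> wins.simps(2)[of _ _ "Suc 0"] by (intro allI impI) (rule round)
  qed
qed (use forest_after_first_move(2)[of 5] in auto)

section \<open>Boards on which Alice cannot win\<close>

text \<open>Some play against arbitrary answers of Bob finishes, and a winning strategy would make
  it end with a blue copy, which needs \<open>n\<close> vertices.\<close>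

lemma no_winning_strategy_small:
  assumes "N < n"
  shows "\<not> winning_strategy (path_graph n) N \<sigma>"
proof
  assume \<sigma>: "winning_strategy (path_graph n) N \<sigma>"
  then have "legal_strategy (path_graph n) N \<sigma>" by (simp add: winning_strategy_def)
  then obtain h where "legal_history (path_graph n) N h" "game_over (path_graph n) N h" "follows \<sigma> h"
    by (rule exists_finished_play[where I = "\<lambda>_. True"]) (auto simp: legal_history_def game_over_def)
  with \<sigma> have "contains_copy (blue_graph N h) (path_graph n)"
    by (simp add: winning_strategy_def)
  then have "n \<le> N" using path_copy_card_vertices by (auto simp: blue_graph_eq)
  with assms show False by simp
qed

text \<open>
  On \<open>K\<^sub>4\<close>, Bob always answers with the complementary edge. Then no two blue edges are disjoint,
  whereas the end edges of \<open>P\<^sub>4\<close> are.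
\<close>

lemma no_winning_strategy_P4:
  "\<not> winning_strategy (path_graph 4) 4 \<sigma>"
proof
  assume \<sigma>: "winning_strategy (path_graph 4) 4 \<sigma>"
  let ?V = "{..<4::nat}" and ?E = "snd (complete_graph 4)"
  \<comment> \<open>Complementation exchanges the two colours; this holds whenever Bob has just
    answered.\<close>
  define I where "I h \<longleftrightarrow> (\<forall>e\<in>blue h. ?V - e \<in> red h) \<and> (\<forall>e\<in>red h. ?V - e \<in> blue h)" for h
  have E: "e \<in> ?E \<longleftrightarrow> e \<subseteq> ?V \<and> card e = 2" for e
  proof
    assume "e \<in> ?E"
    then show "e \<subseteq> ?V \<and> card e = 2" by (auto simp: complete_graph_pairs pairs_def)
  next
    assume "e \<subseteq> ?V \<and> card e = 2"
    then obtain u v where "e = {u, v}" "u \<noteq> v" "u \<in> ?V" "v \<in> ?V"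
      unfolding card_2_iff by (metis insert_subset)
    then show "e \<in> ?E" by (simp add: complete_graph_pairs pairsI)
  qed
  have compl: "?V - e \<in> ?E" "?V - (?V - e) = e" "?V - e \<noteq> e" if "e \<in> ?E" for e
  proof -
    from that have e: "e \<subseteq> ?V" "card e = 2" by (simp_all add: E)
    then show "?V - e \<in> ?E" by (simp add: E card_Diff_subset finite_subset)
    show "?V - (?V - e) = e" using e(1) by blast
    show "?V - e \<noteq> e" using e by (metis Diff_disjoint card.empty inf.idem zero_neq_numeral)
  qed
  \<comment> \<open>The coloured edges are closed under complement, so the complement of a free edge
    is free and Bob's answer is legal.\<close>
  have closed: "?V - e \<notin> set h" if "I h" "e \<in> ?E - set h" for h e
  proof
    assume "?V - e \<in> set h"
    with that(1) have "?V - (?V - e) \<in> set h"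
      unfolding I_def blue_Un_red[symmetric] by blast
    with compl that(2) show False by auto
  qed
  have "legal_strategy (path_graph 4) 4 \<sigma>" using \<sigma> by (simp add: winning_strategy_def)
  then obtain h where h: "legal_history (path_graph 4) 4 h" "game_over (path_graph 4) 4 h" "follows \<sigma> h"
    "I h \<and> even (length h) \<or> (\<exists>g e. h = g @ [e] \<and> I g \<and> even (length g))"
  proof (rule exists_finished_play[where I = I])
    show "I []" by (simp add: I_def)
    fix h e assume h: "I h" "even (length h)" "e \<in> ?E - set h"
    have "I (h @ [e, ?V - e])"
      using h compl blue_snoc[of "h @ [e]" "?V - e"] red_snoc[of "h @ [e]" "?V - e"]
      by (auto simp: I_def blue_snoc red_snoc)
    moreover have "?V - e \<in> ?E - set (h @ [e])"
      using closed[OF h(1,3)] compl h(3) by auto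
    ultimately show "\<exists>f\<in>?E - set (h @ [e]). I (h @ [e, f])" by blast
  qed
  have free: "?V - e \<notin> blue g" if "I g" "distinct g" "e \<in> blue g" for g e
    using that blue_Int_red by (auto simp: I_def)
  have no_compl: "?V - e \<notin> blue h" if e: "e \<in> blue h" for e
    using h(4)
  proof (elim disjE exE conjE)
    assume "I h"
    with free e h(1) show ?thesis by (auto simp: legal_history_def)
  next
    \<comment> \<open>Here Alice's last edge \<open>e'\<close> ended the play unanswered. Its
      complement is still free, so the new blue edge creates no complementary pair.\<close>
    fix g e' assume g: "h = g @ [e']" "I g" "even (length g)"
    with h(1) have d: "distinct g" "e' \<in> ?E - set g" "set g \<subseteq> ?E" by (auto simp: legal_history_def)
    have "blue g \<subseteq> set g" by (auto simp flip: blue_Un_red)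
    have new: "?V - e' \<notin> blue g" "?V - e' \<noteq> e'"
      using closed[OF g(2) d(2)] \<open>blue g \<subseteq> set g\<close> compl(3)[of e'] d(2) by auto
    have old: "?V - e \<notin> blue g" "?V - e \<noteq> e'" if "e \<in> blue g"
    proof -
      show "?V - e \<notin> blue g" using free[OF g(2) d(1) that] .
      show "?V - e \<noteq> e'" using compl(2)[of e] new(1) that \<open>blue g \<subseteq> set g\<close> d(3) by auto
    qed
    have "blue h = insert e' (blue g)" using g by (simp add: blue_snoc)
    with e new old show ?thesis by (cases "e = e'") auto
  qed
  have "contains_copy (blue_graph 4 h) (path_graph 4)"
    using \<sigma> h by (simp add: winning_strategy_def)
  then obtain f where f: "inj_on f ?V" "f ` ?V \<subseteq> ?V" "\<And>i. Suc i < 4 \<Longrightarrow> {f i, f (Suc i)} \<in> blue h"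
    unfolding blue_graph_eq by (rule path_copyE) blast
  \<comment> \<open>The copy uses all four vertices, hence its end edges \<open>{f 0, f 1}\<close>
    and \<open>{f 2, f 3}\<close> are complementary, and both are blue.\<close>
  have "f ` ?V = ?V" using f(1,2) by (simp add: endo_inj_surj)
  moreover have four: "?V = {0, 1, 2, 3}" by auto
  ultimately have V: "?V = {f 0, f 1, f 2, f 3}" by simp
  have "f 2 \<noteq> f 0" "f 2 \<noteq> f 1" "f 3 \<noteq> f 0" "f 3 \<noteq> f 1"
    by (simp_all add: inj_on_eq_iff[OF f(1)])
  with V have "?V - {f 0, f 1} = {f 2, f 3}" by auto
  with no_compl[of "{f 0, f 1}"] f(3)[of 0] f(3)[of 2] show False
    by simp
qed

theorem theorem5:
  fixes n :: nat
  assumes "n \<ge> 3"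
  shows "achievement_number (path_graph n) = (if n = 3 then 3 else if n = 4 then 5 else n)"
  unfolding achievement_number_def
proof (rule Least_equality)
  show "\<exists>\<sigma>. winning_strategy (path_graph n) (if n = 3 then 3 else if n = 4 then 5 else n) \<sigma>"
    using assms Alice_wins_P3 Alice_wins_P4 Alice_wins_ham_path[of n] by auto
  fix N assume "\<exists>\<sigma>. winning_strategy (path_graph n) N \<sigma>"
  then have "n \<le> N" "n = 4 \<Longrightarrow> N \<noteq> 4"
    using no_winning_strategy_small[of N n] no_winning_strategy_P4 by (auto simp: not_less[symmetric])
  then show "(if n = 3 then 3 else if n = 4 then 5 else n) \<le> N"
    by auto
qed

end
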